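(* Let $X$ be a Banach space and let $S=(X;X_k,k\geqslant 1)$ be a system of closed linear subspaces of $X$. Then $S$ is an absolutely representing system of subspaces in $X$ if and only if there exists $\varepsilon>0$ such that $$\sup_{k}\|\varphi^{(S,k)}\|\geqslant\varepsilon\|\varphi\|\quad\text{for all }\varphi\in X^*.$$
   Context: $X$ is a Banach space over $\mathbb{K}$ ($=\mathbb{R}$ or $\mathbb{C}$), $X^*$ is its dual. For $\varphi\in X^*$, $\varphi^{(S,k)}\in X_k^*$ denotes the restriction of $\varphi$ to $X_k$. A system $S=(X;X_k,k\geqslant 1)$ of closed linear subspaces of $X$ is an absolutely representing system of subspaces in $X$ if every $x\in X$ can be written as $x=\sum_{k=1}^\infty x_k$ with $x_k\in X_k$, $k\geqslant 1$, and $\sum_{k=1}^\infty\|x_k\|<\infty$. *)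

theory Defs
  imports "HOL-Analysis.Analysis"
begin

(* The two admissible scalar fields: up to isometric isomorphism, exactly \<real> and \<complex>. *)
class real_or_complex = real_normed_field +
  assumes real_or_complex:
    "\<exists>f :: 'a \<Rightarrow> complex. (\<forall>x y. f (x + y) = f x + f y) \<and> (\<forall>r x. f (r *\<^sub>R x) = r *\<^sub>R f x) \<and>
       f 1 = 1 \<and> (\<forall>x y. f (x * y) = f x * f y) \<and>
       (\<forall>x. norm (f x) = norm x) \<and> (range f = \<real> \<or> range f = UNIV)"

instance real :: real_or_complex
proof
  show "\<exists>f :: real \<Rightarrow> complex. (\<forall>x y. f (x + y) = f x + f y) \<and> (\<forall>r x. f (r *\<^sub>R x) = r *\<^sub>R f x) \<and>
       f 1 = 1 \<and> (\<forall>x y. f (x * y) = f x * f y) \<and>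
       (\<forall>x. norm (f x) = norm x) \<and> (range f = \<real> \<or> range f = UNIV)"
    by (rule exI[where x = "complex_of_real"], simp add: Reals_def scaleR_conv_of_real)
qed

instance complex :: real_or_complex
proof
  show "\<exists>f :: complex \<Rightarrow> complex. (\<forall>x y. f (x + y) = f x + f y) \<and> (\<forall>r x. f (r *\<^sub>R x) = r *\<^sub>R f x) \<and>
       f 1 = 1 \<and> (\<forall>x y. f (x * y) = f x * f y) \<and>
       (\<forall>x. norm (f x) = norm x) \<and> (range f = \<real> \<or> range f = UNIV)"
    by (rule exI[where x = "\<lambda>z. z"], simp)
qed

(* The library only has real normed spaces. A normed space over 'k is a real normed space
   together with a 'k-scalar multiplication that extends the real one; it is Banach over 'k
   iff the type is of class banach, since completeness depends on the norm only. *)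
locale normed_space_over = vector_space scl
  for scl :: "'k::real_or_complex \<Rightarrow> 'a::real_normed_vector \<Rightarrow> 'a" +
  assumes scale_of_real: "scl (of_real r) x = r *\<^sub>R x"
    and norm_scale: "norm (scl c x) = norm c * norm x"

lemma normed_space_over_scaleR:
  "normed_space_over (scaleR :: real \<Rightarrow> 'a::real_normed_vector \<Rightarrow> 'a)"
  by unfold_locales (simp_all add: scaleR_add_right scaleR_add_left)

lemma normed_space_over_complex: "normed_space_over ((*) :: complex \<Rightarrow> complex \<Rightarrow> complex)"
  by unfold_locales (simp_all add: distrib_left distrib_right norm_mult scaleR_conv_of_real)

definition dual_space ::
    "('k::real_or_complex \<Rightarrow> 'a::real_normed_vector \<Rightarrow> 'a) \<Rightarrow> ('a \<Rightarrow> 'k) set" where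
  "dual_space scl = {\<phi>. bounded_linear \<phi> \<and> (\<forall>c x. \<phi> (scl c x) = c * \<phi> x)}"

(* Norm of the restriction of f to the subspace M, written as in the definition of onorm,
   so that onorm_on UNIV = onorm. At x = 0 the quotient is 0. *)
definition onorm_on ::
    "'a::real_normed_vector set \<Rightarrow> ('a \<Rightarrow> 'b::real_normed_vector) \<Rightarrow> real" where
  "onorm_on M f = (SUP x\<in>M. norm (f x) / norm x)"

lemma onorm_on_UNIV: "onorm_on UNIV f = onorm f"
  by (simp add: onorm_on_def onorm_def)

(* Systems are indexed from 0: X k stands for the (k+1)-st subspace. *)
definition absolutely_representing_system :: "(nat \<Rightarrow> 'a::banach set) \<Rightarrow> bool" where
  "absolutely_representing_system X \<longleftrightarrow>
     (\<forall>v. \<exists>x. (\<forall>k. x k \<in> X k) \<and> x sums v \<and> summable (\<lambda>k. norm (x k)))"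

end

theory Submission
  imports Defs
begin

text \<open>
  For a coefficient sequence \<open>x\<close> with \<open>x k \<in> X k\<close> and \<open>\<Sum>\<parallel>x k\<parallel> < \<infinity>\<close> write \<open>T x = \<Sum>x k\<close>; these
  sequences are the vectors of the \<open>\<ell>\<^sup>1\<close>-sum of the subspaces, and the system is absolutely
  representing iff \<open>T\<close> is onto. The dual of the \<open>\<ell>\<^sup>1\<close>-sum is an \<open>\<ell>\<^sup>\<infinity>\<close>-sum, and the condition
  on the functionals says that the adjoint of \<open>T\<close> is bounded below.

  If \<open>T\<close> is onto, the space is the union of the images of the balls of radius \<open>n\<close>, so by Baire
  the closure of one of the images contains a ball (\<open>representing_imp_ball_in_closure\<close>). A
  functional \<open>\<phi>\<close> is bounded on the image by \<open>n * sup\<^sub>k \<parallel>\<phi>|X k\<parallel>\<close>, hence also on the ball, which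
  bounds its norm (\<open>representing_imp_norming\<close>).

  Conversely, for \<open>\<delta> > 0\<close> let \<open>q v\<close> be the infimum of \<open>\<parallel>v - T x\<parallel> / \<delta> + \<Sum>\<parallel>x k\<parallel>\<close> over all coefficient
  sequences \<open>x\<close>. This is a seminorm, with \<open>q v \<le> \<parallel>v\<parallel> / \<delta>\<close> everywhere and \<open>q v \<le> \<parallel>v\<parallel>\<close> on each
  \<open>X k\<close>. By Hahn and Banach (\<open>hahn_banach_seminorm\<close>) there is a functional \<open>\<phi>\<close> with \<open>|\<phi>| \<le> q\<close>
  and \<open>|\<phi> y| = q y\<close>; its restrictions to the \<open>X k\<close> have norm at most \<open>1\<close>, so \<open>\<epsilon> * \<parallel>\<phi>\<parallel> \<le> 1\<close> and
  \<open>q y \<le> \<parallel>y\<parallel> / \<epsilon>\<close>, whatever \<open>\<delta>\<close> is (\<open>defect_le\<close>). With \<open>\<delta> = \<epsilon> / 4\<close> this yields, for each \<open>y\<close>,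
  a coefficient sequence whose sum approximates \<open>y\<close> up to \<open>\<parallel>y\<parallel> / 2\<close> at cost \<open>(2 / \<epsilon>) * \<parallel>y\<parallel>\<close>.
  Iterating on the remainders and adding up the coefficients gives an exact representation
  (\<open>half_approximation_imp_representing\<close>).
\<close>

section \<open>Sublinear functionals and the Hahn-Banach theorem\<close>

text \<open>Subadditive and positively homogeneous; the factor \<open>0\<close> is included, so \<open>p 0 = 0\<close>.\<close>

definition sublinear :: "('a::real_vector \<Rightarrow> real) \<Rightarrow> bool" where
  "sublinear p \<longleftrightarrow> (\<forall>x y. p (x + y) \<le> p x + p y) \<and> (\<forall>t\<ge>0. \<forall>x. p (t *\<^sub>R x) = t * p x)"

lemma sublinear_add: "sublinear p \<Longrightarrow> p (x + y) \<le> p x + p y"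
  and sublinear_scale: "sublinear p \<Longrightarrow> t \<ge> 0 \<Longrightarrow> p (t *\<^sub>R x) = t * p x"
  by (auto simp: sublinear_def)

lemma sublinear_zero: "sublinear p \<Longrightarrow> p 0 = 0"
  using sublinear_scale[of p 0 0] by simp

lemma sublinear_minus_ge: "sublinear p \<Longrightarrow> - p (- x) \<le> p x"
  using sublinear_add[of p x "- x"] sublinear_zero[of p] by simp

text \<open>For positive factors an inequality suffices, as the inverse factor gives the converse one.\<close>

lemma sublinearI:
  assumes add: "\<And>x y. p (x + y) \<le> p x + p y"
    and zero: "p 0 = 0"
    and scale: "\<And>t x. t > 0 \<Longrightarrow> p (t *\<^sub>R x) \<le> t * p x"
  shows "sublinear p"
  unfolding sublinear_def
proof (intro conjI allI impI add)
  fix t :: real and x assume t: "0 \<le> t"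
  show "p (t *\<^sub>R x) = t * p x"
  proof (cases "t = 0")
    case False
    with t have t: "t > 0" by simp
    have "p ((1 / t) *\<^sub>R (t *\<^sub>R x)) \<le> 1 / t * p (t *\<^sub>R x)"
      using t by (intro scale) simp
    with t have "t * p x \<le> p (t *\<^sub>R x)" by (simp add: field_simps)
    with scale[OF t, of x] show ?thesis by simp
  qed (simp add: zero)
qed

lemma sublinear_neg_imp_linear:
  assumes p: "sublinear p" and neg: "\<And>y. p (- y) \<le> - p y"
  shows "linear p"
proof -
  have minus: "p (- y) = - p y" for y
    using neg[of y] sublinear_minus_ge[OF p, of y] by simp
  show ?thesis
  proof (rule linearI)
    fix x y
    have "p (- x + - y) \<le> p (- x) + p (- y)" by (rule sublinear_add[OF p])
    moreover have "- x + - y = - (x + y)" by simp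
    ultimately have "p x + p y \<le> p (x + y)" by (simp only: minus)
    with sublinear_add[OF p, of x y] show "p (x + y) = p x + p y" by simp
  next
    fix r :: real and x
    show "p (r *\<^sub>R x) = r *\<^sub>R p x"
    proof (cases "r \<ge> 0")
      case False
      then have "p ((- r) *\<^sub>R x) = (- r) * p x" by (intro sublinear_scale[OF p]) simp
      then show ?thesis using minus[of "r *\<^sub>R x"] by simp
    qed (simp add: sublinear_scale[OF p])
  qed
qed

text \<open>
  A sublinear functional can be lowered so that it becomes additive on the line through \<open>y\<close>.
\<close>

lemma sublinear_lowering:
  fixes p :: "'a::real_vector \<Rightarrow> real"
  assumes p: "sublinear p"
  obtains p' where "sublinear p'" "p' \<le> p" "p' (- y) \<le> - p y"
proof
  let ?p' = "\<lambda>x. INF t\<in>{0..}. p (x + t *\<^sub>R y) - t * p y"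
  have bdd: "bdd_below ((\<lambda>t. p (x + t *\<^sub>R y) - t * p y) ` {0..})" for x
  proof (rule bdd_belowI2)
    fix t :: real assume "t \<in> {0..}"
    then have "t * p y = p ((x + t *\<^sub>R y) + (- x))" by (simp add: sublinear_scale[OF p])
    also have "\<dots> \<le> p (x + t *\<^sub>R y) + p (- x)" by (rule sublinear_add[OF p])
    finally show "- p (- x) \<le> p (x + t *\<^sub>R y) - t * p y" by simp
  qed
  have le: "?p' x \<le> p (x + t *\<^sub>R y) - t * p y" if "t \<ge> 0" for x t
    using that by (intro cINF_lower bdd) simp
  have ge: "m \<le> ?p' x" if "\<And>t. t \<ge> 0 \<Longrightarrow> m \<le> p (x + t *\<^sub>R y) - t * p y" for m x
    using that by (intro cINF_greatest) auto
  show "?p' \<le> p"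
    using le[of 0] by (auto simp: le_fun_def)
  show "?p' (- y) \<le> - p y"
    using le[of 1 "- y"] sublinear_zero[OF p] by simp
  show "sublinear ?p'"
  proof (rule sublinearI)
    fix x x'
    have "?p' (x + x') - (p (x' + s *\<^sub>R y) - s * p y) \<le> ?p' x" if s: "s \<ge> 0" for s
    proof (rule ge)
      fix t :: real assume t: "t \<ge> 0"
      have "?p' (x + x') \<le> p ((x + x') + (t + s) *\<^sub>R y) - (t + s) * p y"
        using s t by (intro le) simp
      moreover have "p ((x + x') + (t + s) *\<^sub>R y) \<le> p (x + t *\<^sub>R y) + p (x' + s *\<^sub>R y)"
        using sublinear_add[OF p, of "x + t *\<^sub>R y" "x' + s *\<^sub>R y"] by (simp add: algebra_simps)
      ultimately show "?p' (x + x') - (p (x' + s *\<^sub>R y) - s * p y) \<le> p (x + t *\<^sub>R y) - t * p y"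
        by (simp add: algebra_simps)
    qed
    then have "?p' (x + x') - ?p' x \<le> ?p' x'"
      by (intro ge) (smt (verit))
    then show "?p' (x + x') \<le> ?p' x + ?p' x'" by simp
  next
    show "?p' 0 = 0"
    proof (rule antisym)
      show "?p' 0 \<le> 0" using le[of 0 0] sublinear_zero[OF p] by simp
      show "0 \<le> ?p' 0" by (rule ge) (simp add: sublinear_scale[OF p])
    qed
  next
    fix c :: real and x assume c: "c > 0"
    have "?p' (c *\<^sub>R x) / c \<le> ?p' x"
    proof (rule ge)
      fix t :: real assume t: "t \<ge> 0"
      have "?p' (c *\<^sub>R x) \<le> p (c *\<^sub>R x + (c * t) *\<^sub>R y) - (c * t) * p y"
        using c t by (intro le) simp
      also have "c *\<^sub>R x + (c * t) *\<^sub>R y = c *\<^sub>R (x + t *\<^sub>R y)" by (simp add: scaleR_add_right)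
      also have "p (c *\<^sub>R (x + t *\<^sub>R y)) = c * p (x + t *\<^sub>R y)"
        using c by (intro sublinear_scale[OF p]) simp
      finally show "?p' (c *\<^sub>R x) / c \<le> p (x + t *\<^sub>R y) - t * p y"
        using c by (simp add: field_simps)
    qed
    with c show "?p' (c *\<^sub>R x) \<le> c * ?p' x" by (simp add: field_simps)
  qed
qed

lemma sublinear_INF_chain:
  fixes C :: "('a::real_vector \<Rightarrow> real) set"
  assumes ne: "C \<noteq> {}" and sub: "\<And>p. p \<in> C \<Longrightarrow> sublinear p"
    and bound: "\<And>p. p \<in> C \<Longrightarrow> p \<le> q"
    and chain: "\<And>p p'. p \<in> C \<Longrightarrow> p' \<in> C \<Longrightarrow> p \<le> p' \<or> p' \<le> p"
  obtains u where "sublinear u" "\<And>p. p \<in> C \<Longrightarrow> u \<le> p"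
proof
  let ?u = "\<lambda>x. INF p\<in>C. p x"
  have bdd: "bdd_below ((\<lambda>p. p x) ` C)" for x
  proof (rule bdd_belowI2)
    fix p assume p: "p \<in> C"
    show "- q (- x) \<le> p x"
      using sublinear_minus_ge[OF sub[OF p], of x] le_funD[OF bound[OF p], of "- x"] by simp
  qed
  have le: "?u x \<le> p x" if "p \<in> C" for x p
    using that by (intro cINF_lower bdd)
  have ge: "m \<le> ?u x" if "\<And>p. p \<in> C \<Longrightarrow> m \<le> p x" for m x
    using that ne by (intro cINF_greatest)
  show "?u \<le> p" if "p \<in> C" for p
    using le[OF that] by (simp add: le_fun_def)
  show "sublinear ?u"
  proof (rule sublinearI)
    fix x y
    have "?u (x + y) - p' y \<le> ?u x" if p': "p' \<in> C" for p'
    proof (rule ge)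
      fix p assume p: "p \<in> C"
      \<comment> \<open>The smaller one of the two functionals serves for both summands.\<close>
      from chain[OF p p'] obtain r where r: "r \<in> C" "r \<le> p" "r \<le> p'"
        using p p' by auto
      have "?u (x + y) \<le> r (x + y)" using r by (intro le)
      also have "\<dots> \<le> r x + r y" using r by (intro sublinear_add sub)
      also have "\<dots> \<le> p x + p' y" using r by (intro add_mono) (auto simp: le_fun_def)
      finally show "?u (x + y) - p' y \<le> p x" by simp
    qed
    then have "?u (x + y) - ?u x \<le> ?u y" by (intro ge) (smt (verit))
    then show "?u (x + y) \<le> ?u x + ?u y" by simp
  next
    have "(\<lambda>p. p 0) ` C = {0}" using ne sub sublinear_zero by force
    then show "?u 0 = 0" by simp
  next
    fix t :: real and x assume t: "t > 0"
    have "?u (t *\<^sub>R x) / t \<le> ?u x"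
    proof (rule ge)
      fix p assume p: "p \<in> C"
      have "?u (t *\<^sub>R x) \<le> t * p x"
        using le[OF p, of "t *\<^sub>R x"] sublinear_scale[OF sub[OF p], of t x] t by simp
      with t show "?u (t *\<^sub>R x) / t \<le> p x" by (simp add: field_simps)
    qed
    with t show "?u (t *\<^sub>R x) \<le> t * ?u x" by (simp add: field_simps)
  qed
qed

text \<open>
  A sublinear functional that is minimal below \<open>q\<close> equals each of its lowerings, hence is linear.
\<close>

lemma linear_below_sublinear:
  fixes q :: "'a::real_vector \<Rightarrow> real"
  assumes q: "sublinear q"
  obtains \<phi> where "linear \<phi>" "\<phi> \<le> q"
proof -
  let ?A = "{p. sublinear p \<and> p \<le> q}"
  have "\<exists>m\<in>?A. \<forall>a\<in>?A. m \<ge> a \<longrightarrow> a = m"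
  proof (rule predicate_Zorn)
    show "partial_order_on ?A (relation_of (\<ge>) ?A)"
      by (rule partial_order_on_relation_ofI) auto
  next
    fix C assume C: "C \<in> Chains (relation_of (\<ge>) ?A)"
    show "\<exists>u\<in>?A. \<forall>a\<in>C. u \<le> a"
    proof (cases "C = {}")
      case True
      then show ?thesis using q by auto
    next
      case False
      have mem: "p \<in> ?A" if "p \<in> C" for p
        using C that by (auto simp: Chains_def relation_of_def)
      have chain: "p \<le> p' \<or> p' \<le> p" if "p \<in> C" "p' \<in> C" for p p'
        using C that by (auto simp: Chains_def relation_of_def)
      obtain u where u: "sublinear u" "\<And>p. p \<in> C \<Longrightarrow> u \<le> p"
        using sublinear_INF_chain[of C q] False mem chain by (auto simp: mem_Collect_eq)
      then have "u \<le> q" using False mem by (metis (no_types, lifting) all_not_in_conv mem_Collect_eq order_trans)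
      with u show ?thesis by blast
    qed
  qed
  then obtain m where m: "sublinear m" "m \<le> q"
    and min: "\<And>a. sublinear a \<Longrightarrow> a \<le> q \<Longrightarrow> a \<le> m \<Longrightarrow> a = m" by auto
  have "linear m"
  proof (rule sublinear_neg_imp_linear[OF m(1)])
    fix y
    obtain p' where p': "sublinear p'" "p' \<le> m" "p' (- y) \<le> - m y"
      using sublinear_lowering[OF m(1)] by blast
    moreover have "p' \<le> q" using p'(2) m(2) by (rule order_trans)
    ultimately have "p' = m" by (intro min)
    with p'(3) show "m (- y) \<le> - m y" by simp
  qed
  with m(2) show ?thesis by (intro that)
qed

text \<open>Lowering \<open>q\<close> along \<open>y\<close> first forces the minorant to attain \<open>q\<close> at \<open>y\<close>.\<close>

lemma hahn_banach_sublinear: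
  fixes q :: "'a::real_vector \<Rightarrow> real"
  assumes q: "sublinear q"
  obtains \<phi> where "linear \<phi>" "\<phi> \<le> q" "\<phi> y = q y"
proof -
  obtain p where p: "sublinear p" "p \<le> q" "p (- y) \<le> - q y"
    using sublinear_lowering[OF q] by blast
  obtain \<phi> where \<phi>: "linear \<phi>" "\<phi> \<le> p"
    using linear_below_sublinear[OF p(1)] by blast
  have le: "\<phi> \<le> q" using \<phi>(2) p(2) by (rule order_trans)
  have "- \<phi> y \<le> - q y"
    using le_funD[OF \<phi>(2), of "- y"] p(3) linear_neg[OF \<phi>(1), of y] by simp
  with le_funD[OF le, of y] have "\<phi> y = q y" by simp
  with \<phi>(1) le show ?thesis by (intro that)
qed

section \<open>Functionals over the scalar field\<close>

text \<open>
  The real part on the scalar field, and the structure of the field as a real vector space: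
  either all scalars are real or there is an imaginary unit.
\<close>

lemma real_or_complex_real_part:
  obtains re :: "'k::real_or_complex \<Rightarrow> real"
  where "\<And>c. \<bar>re c\<bar> \<le> norm c"
    and "(\<forall>c. c = of_real (re c)) \<or>
      (\<exists>i. i * i = - 1 \<and> (\<forall>c. \<exists>b. c = of_real (re c) + of_real b * i) \<and>
        (\<forall>a b. re (of_real a + of_real b * i) = a))"
    and "\<And>r. re (of_real r) = r"
proof -
  obtain f :: "'k \<Rightarrow> complex" where add: "\<And>x y. f (x + y) = f x + f y"
    and scale: "\<And>r x. f (r *\<^sub>R x) = r *\<^sub>R f x" and one: "f 1 = 1"
    and mult: "\<And>x y. f (x * y) = f x * f y"
    and nrm: "\<And>x. norm (f x) = norm x" and rng: "range f = \<real> \<or> range f = UNIV"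
    using real_or_complex by blast
  have lin: "linear f" by (rule linearI) (simp_all add: add scale)
  have inj: "x = y" if "f x = f y" for x y
    using that nrm[of "x - y"] linear_diff[OF lin, of x y] by simp
  have real: "f (of_real r) = of_real r" for r
    by (simp add: of_real_def scale one)
  show ?thesis
  proof (rule that[of "\<lambda>c. Re (f c)"])
    show "\<bar>Re (f c)\<bar> \<le> norm c" for c
      using abs_Re_le_cmod[of "f c"] by (simp add: nrm)
    show "Re (f (of_real r)) = r" for r by (simp add: real)
    show "(\<forall>c. c = of_real (Re (f c))) \<or>
      (\<exists>i. i * i = - 1 \<and> (\<forall>c. \<exists>b. c = of_real (Re (f c)) + of_real b * i) \<and>
        (\<forall>a b. Re (f (of_real a + of_real b * i)) = a))"
      using rng
    proof
      assume "range f = \<real>"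
      then have "f c = f (of_real (Re (f c)))" for c
        using rangeI[of f c] by (simp add: real)
      then have "\<forall>c. c = of_real (Re (f c))" using inj by blast
      then show ?thesis ..
    next
      assume "range f = UNIV"
      then obtain i where i: "f i = \<i>" by (metis surjD)
      have "i * i = - 1"
        by (rule inj) (simp add: mult i linear_neg[OF lin] one)
      moreover have "c = of_real (Re (f c)) + of_real (Im (f c)) * i" for c
        by (rule inj) (simp add: add mult real i complex_eq mult.commute)
      moreover have "Re (f (of_real a + of_real b * i)) = a" for a b
        by (simp add: add mult real i)
      ultimately show ?thesis by blast
    qed
  qed
qed

context normed_space_over
begin

lemma bounded_linear_scl: "bounded_linear (scl c)"
proof (rule bounded_linear_intro)
  show "scl c (x + y) = scl c x + scl c y" for x y by (rule scale_right_distrib)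
  show "scl c (r *\<^sub>R x) = r *\<^sub>R scl c x" for r x
    by (metis scale_of_real scale_left_commute)
  show "norm (scl c x) \<le> norm x * norm c" for x by (simp add: norm_scale)
qed

text \<open>
  A real-linear functional is the real part of a functional that is linear over the scalar
  field; in the complex case this is \<open>x \<mapsto> \<phi> x - i * \<phi> (i x)\<close>.
\<close>

lemma real_linear_is_real_part:
  assumes \<phi>: "linear \<phi>"
  obtains \<psi> :: "'a \<Rightarrow> 'k" and re :: "'k \<Rightarrow> real"
  where "\<And>x y. \<psi> (x + y) = \<psi> x + \<psi> y" and "\<And>c x. \<psi> (scl c x) = c * \<psi> x"
    and "\<And>x. re (\<psi> x) = \<phi> x" and "\<And>c. \<bar>re c\<bar> \<le> norm c" and "\<And>r. re (of_real r) = r"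
proof -
  obtain re :: "'k \<Rightarrow> real" where le: "\<And>c. \<bar>re c\<bar> \<le> norm c"
    and cases: "(\<forall>c. c = of_real (re c)) \<or>
      (\<exists>i. i * i = - 1 \<and> (\<forall>c. \<exists>b. c = of_real (re c) + of_real b * i) \<and>
        (\<forall>a b. re (of_real a + of_real b * i) = a))"
    and real: "\<And>r. re (of_real r) = r"
    using real_or_complex_real_part by metis
  have \<phi>_add: "\<phi> (x + y) = \<phi> x + \<phi> y" for x y by (rule linear_add[OF \<phi>])
  have \<phi>_scale: "\<phi> (scl (of_real r) x) = r * \<phi> x" for r x
    by (simp add: scale_of_real linear_cmul[OF \<phi>])
  from cases show ?thesis
  proof
    assume all_real: "\<forall>c. c = of_real (re c)"
    show ?thesis
    proof (rule that[of "\<lambda>x. of_real (\<phi> x)" re])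
      fix c :: 'k and x
      obtain r where r: "c = of_real r" using all_real by blast
      show "of_real (\<phi> (scl c x)) = c * of_real (\<phi> x)" by (simp add: r \<phi>_scale)
    qed (simp_all add: \<phi>_add real le)
  next
    assume "\<exists>i. i * i = - 1 \<and> (\<forall>c. \<exists>b. c = of_real (re c) + of_real b * i) \<and>
        (\<forall>a b. re (of_real a + of_real b * i) = a)"
    then obtain i where ii: "i * i = - 1" and ex: "\<And>c. \<exists>b. c = of_real (re c) + of_real b * i"
      and re: "\<And>a b. re (of_real a + of_real b * i) = a" by blast
    let ?\<psi> = "\<lambda>x. of_real (\<phi> x) + of_real (- \<phi> (scl i x)) * i"
    show ?thesis
    proof (rule that[of ?\<psi> re])
      show "?\<psi> (x + y) = ?\<psi> x + ?\<psi> y" for x y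
        by (simp add: \<phi>_add scale_right_distrib algebra_simps)
    next
      fix c :: 'k and x
      obtain a b where c: "c = of_real a + of_real b * i" using ex by blast
      have re_part: "\<phi> (scl c x) = a * \<phi> x + b * \<phi> (scl i x)"
        by (simp add: c scale_left_distrib \<phi>_add \<phi>_scale flip: scale_scale)
      have "scl i (scl c x) = scl (of_real a) (scl i x) + scl (of_real (- b)) x"
      proof -
        have "i * c = of_real a * i + of_real (- b)"
          by (simp add: c distrib_left mult.left_commute[of i] ii mult.commute[of i "of_real a"])
        then have "scl i (scl c x) = scl (of_real a * i + of_real (- b)) x" by simp
        then show ?thesis by (simp add: scale_left_distrib del: of_real_minus)
      qed
      then have im_part: "\<phi> (scl i (scl c x)) = a * \<phi> (scl i x) + (- b) * \<phi> x"
        by (simp only: \<phi>_add \<phi>_scale)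
      have i_i: "i * (i * z) = - z" for z
        by (metis ii mult.assoc mult_minus1)
      show "?\<psi> (scl c x) = c * ?\<psi> x"
        by (simp only: re_part im_part) (simp add: c algebra_simps i_i)
    qed (simp_all only: re le real)
  qed
qed

text \<open>
  The Hahn-Banach theorem for a continuous seminorm \<open>q\<close>, over the real or complex scalars.
\<close>

theorem hahn_banach_seminorm:
  assumes add: "\<And>x y. q (x + y) \<le> q x + q y"
    and scale: "\<And>c x. q (scl c x) = norm c * q x"
    and bound: "\<And>x. q x \<le> norm x * K"
  obtains \<psi> where "\<psi> \<in> dual_space scl" "\<And>x. norm (\<psi> x) \<le> q x" "norm (\<psi> y) = q y"
proof -
  have scaleR: "q (t *\<^sub>R x) = \<bar>t\<bar> * q x" for t x
    using scale[of "of_real t" x] by (simp add: scale_of_real)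
  have "sublinear q" by (simp add: sublinear_def add scaleR)
  then obtain \<phi> where \<phi>: "linear \<phi>" "\<phi> \<le> q" "\<phi> y = q y"
    using hahn_banach_sublinear by blast
  obtain \<psi> :: "'a \<Rightarrow> 'k" and re :: "'k \<Rightarrow> real"
    where \<psi>_add: "\<And>x y. \<psi> (x + y) = \<psi> x + \<psi> y" and \<psi>_scl: "\<And>c x. \<psi> (scl c x) = c * \<psi> x"
      and re: "\<And>x. re (\<psi> x) = \<phi> x" and re_le: "\<And>c. \<bar>re c\<bar> \<le> norm c"
      and re_real: "\<And>r. re (of_real r) = r"
    using real_linear_is_real_part[OF \<phi>(1)] by metis
  have le: "norm (\<psi> x) \<le> q x" for x
  proof (cases "\<psi> x = 0")
    case True
    have "0 \<le> q x" using add[of x "- x"] scaleR[of "- 1" x] scaleR[of 0 0] by simp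
    with True show ?thesis by simp
  next
    case False
    \<comment> \<open>Rotate \<open>x\<close> by a unimodular scalar so that the value becomes real.\<close>
    define u where "u = of_real (norm (\<psi> x)) / \<psi> x"
    have u: "norm u = 1" using False by (simp add: u_def norm_divide)
    have "\<psi> (scl u x) = of_real (norm (\<psi> x))" using False by (simp add: \<psi>_scl u_def)
    then have "norm (\<psi> x) = \<phi> (scl u x)" by (metis re re_real)
    also have "\<dots> \<le> q (scl u x)" by (rule le_funD[OF \<phi>(2)])
    also have "\<dots> = q x" by (simp add: scale u)
    finally show ?thesis .
  qed
  have "bounded_linear \<psi>"
  proof (rule bounded_linear_intro)
    show "\<psi> (r *\<^sub>R x) = r *\<^sub>R \<psi> x" for r x
      using \<psi>_scl[of "of_real r" x] by (simp add: scale_of_real scaleR_conv_of_real)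
    show "norm (\<psi> x) \<le> norm x * K" for x
      using le[of x] bound[of x] by simp
  qed (rule \<psi>_add)
  then have "\<psi> \<in> dual_space scl" by (simp add: dual_space_def \<psi>_scl)
  moreover have "norm (\<psi> y) = q y"
    using le[of y] re_le[of "\<psi> y"] by (simp add: re \<phi>(3))
  ultimately show ?thesis using le by (intro that)
qed

end

section \<open>Norms of restrictions\<close>

lemma bdd_above_onorm_on:
  assumes "bounded_linear f"
  shows "bdd_above ((\<lambda>x. norm (f x) / norm x) ` M)"
  by (rule bdd_aboveI2[of _ _ "onorm f"]) (rule le_onorm[OF assms])

lemma onorm_on_bound:
  assumes "bounded_linear f" "x \<in> M"
  shows "norm (f x) \<le> onorm_on M f * norm x"
proof (cases "x = 0")
  case True
  then show ?thesis using linear_0[OF bounded_linear.linear[OF assms(1)]] by simp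
next
  case False
  have "norm (f x) / norm x \<le> onorm_on M f"
    unfolding onorm_on_def using assms by (intro cSUP_upper bdd_above_onorm_on)
  with False show ?thesis by (simp add: field_simps)
qed

lemma onorm_on_le:
  assumes "M \<noteq> {}" "0 \<le> C" "\<And>x. x \<in> M \<Longrightarrow> norm (f x) \<le> C * norm x"
  shows "onorm_on M f \<le> C"
  unfolding onorm_on_def
proof (rule cSUP_least)
  show "norm (f x) / norm x \<le> C" if "x \<in> M" for x
    using assms(3)[OF that] assms(2) by (cases "x = 0") (simp_all add: field_simps)
qed (rule assms(1))

lemma bdd_above_range_onorm_on:
  assumes "bounded_linear f" "\<And>k. X k \<noteq> {}"
  shows "bdd_above (range (\<lambda>k. onorm_on (X k) f))"
  by (rule bdd_aboveI2[of _ _ "onorm f"])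
    (intro onorm_on_le assms onorm onorm_pos_le)

section \<open>Coefficient sequences\<close>

text \<open>
  The absolutely summable sequences with \<open>k\<close>-th term in \<open>X k\<close>, that is, the \<open>\<ell>\<^sup>1\<close>-sum of the
  sets \<open>X k\<close>.
\<close>

definition l1_sequences :: "(nat \<Rightarrow> 'a::real_normed_vector set) \<Rightarrow> (nat \<Rightarrow> 'a) set" where
  "l1_sequences X = {x. (\<forall>k. x k \<in> X k) \<and> summable (\<lambda>k. norm (x k))}"

lemma l1_sequencesD:
  fixes X :: "nat \<Rightarrow> 'a::banach set"
  assumes "x \<in> l1_sequences X"
  shows "x k \<in> X k" "summable (\<lambda>k. norm (x k))" "summable x"
  using assms summable_norm_cancel by (auto simp: l1_sequences_def)

lemma absolutely_representing_system_iff: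
  "absolutely_representing_system X \<longleftrightarrow> (\<forall>v. \<exists>x\<in>l1_sequences X. suminf x = v)"
proof -
  have "(\<exists>x. (\<forall>k. x k \<in> X k) \<and> x sums v \<and> summable (\<lambda>k. norm (x k))) \<longleftrightarrow>
      (\<exists>x\<in>l1_sequences X. suminf x = v)" for v
    using summable_norm_cancel by (auto simp: l1_sequences_def sums_iff)
  then show ?thesis by (simp only: absolutely_representing_system_def)
qed

text \<open>
  Banach spaces over the scalar field. Absolutely summable coefficient sequences have a sum here.
\<close>

locale banach_space_over = normed_space_over scl
  for scl :: "'k::real_or_complex \<Rightarrow> 'a::banach \<Rightarrow> 'a"
begin

lemma l1_sequences_zero:
  assumes "\<And>k. subspace (X k)"
  shows "(\<lambda>k. 0) \<in> l1_sequences X"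
  using assms by (simp add: l1_sequences_def subspace_0)

lemma l1_sequences_scale:
  assumes "\<And>k. subspace (X k)" "x \<in> l1_sequences X"
  shows "(\<lambda>k. scl c (x k)) \<in> l1_sequences X"
  using assms by (auto simp: l1_sequences_def subspace_scale norm_scale intro!: summable_mult)

lemma l1_sequences_add:
  assumes "\<And>k. subspace (X k)" "x \<in> l1_sequences X" "y \<in> l1_sequences X"
  shows "(\<lambda>k. x k + y k) \<in> l1_sequences X"
proof -
  have "summable (\<lambda>k. norm (x k) + norm (y k))"
    using assms by (auto simp: l1_sequences_def intro!: summable_add)
  then have "summable (\<lambda>k. norm (x k + y k))"
    by (rule summable_comparison_test') (simp add: norm_triangle_ineq)
  with assms show ?thesis by (simp add: l1_sequences_def subspace_add)
qed

lemma l1_sequences_single: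
  assumes "\<And>k. subspace (X k)" "v \<in> X k"
  shows "(\<lambda>j. if j = k then v else 0) \<in> l1_sequences X"
proof -
  have "summable (\<lambda>j. norm (if j = k then v else 0))"
    by (rule summable_finite[of "{k}"]) auto
  with assms show ?thesis by (simp add: l1_sequences_def subspace_0)
qed

end

section \<open>A representing system is norming\<close>

lemma functional_bound_on_l1:
  fixes X :: "nat \<Rightarrow> 'a::banach set"
  assumes \<phi>: "bounded_linear \<phi>" and s: "\<And>k. onorm_on (X k) \<phi> \<le> s"
    and x: "x \<in> l1_sequences X"
  shows "norm (\<phi> (suminf x)) \<le> s * (\<Sum>k. norm (x k))"
proof -
  note x = l1_sequencesD[OF x]
  have le: "norm (\<phi> (x k)) \<le> s * norm (x k)" for k
    using onorm_on_bound[OF \<phi> x(1)[of k]] mult_right_mono[OF s[of k], of "norm (x k)"] by simp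
  have "(\<lambda>k. \<phi> (x k)) sums \<phi> (suminf x)"
    by (intro bounded_linear.sums[OF \<phi>] summable_sums x(3))
  then have lim: "(\<lambda>n. norm (\<Sum>k<n. \<phi> (x k))) \<longlonglongrightarrow> norm (\<phi> (suminf x))"
    unfolding sums_def by (rule tendsto_norm)
  have "(\<lambda>k. s * norm (x k)) sums (s * (\<Sum>k. norm (x k)))"
    by (intro sums_mult summable_sums x(2))
  then have "(\<lambda>n. \<Sum>k<n. s * norm (x k)) \<longlonglongrightarrow> s * (\<Sum>k. norm (x k))"
    unfolding sums_def .
  with lim show ?thesis
  proof (rule LIMSEQ_le)
    show "\<exists>N. \<forall>n\<ge>N. norm (\<Sum>k<n. \<phi> (x k)) \<le> (\<Sum>k<n. s * norm (x k))"
      by (intro exI[of _ 0] allI impI sum_norm_le le)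
  qed
qed

text \<open>The images of the balls in the \<open>\<ell>\<^sup>1\<close>-sum exhaust the space, so Baire's theorem applies.\<close>

lemma representing_imp_ball_in_closure:
  fixes X :: "nat \<Rightarrow> 'a::banach set"
  assumes "absolutely_representing_system X"
  obtains v n r where "r > 0"
    "ball v r \<subseteq> closure {suminf x | x. x \<in> l1_sequences X \<and> (\<Sum>k. norm (x k)) \<le> real n}"
proof -
  define B where "B n = {suminf x | x. x \<in> l1_sequences X \<and> (\<Sum>k. norm (x k)) \<le> real n}" for n
  have "\<exists>n. interior (closure (B n)) \<noteq> {}"
  proof (rule ccontr)
    assume "\<not> ?thesis"
    then have dense: "closure (- closure (B n)) = UNIV" for n
      by (simp add: closure_complement)
    have "Met_TC.mtopology closure_of \<Inter> (range (\<lambda>n. - closure (B n))) = (UNIV :: 'a set)"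
    proof (rule Met_TC.metric_Baire_category)
      show "Met_TC.mcomplete TYPE('a)" by (simp add: complete_UNIV)
    qed (use dense in auto)
    moreover have "\<Inter> (range (\<lambda>n. - closure (B n))) = {}"
    proof -
      have "v \<in> (\<Union>n. B n)" for v
      proof -
        obtain x where "x \<in> l1_sequences X" "suminf x = v"
          using assms absolutely_representing_system_iff by blast
        moreover obtain n where "(\<Sum>k. norm (x k)) \<le> real n" using real_arch_simple by blast
        ultimately show ?thesis by (auto simp: B_def)
      qed
      then show ?thesis using closure_subset by fastforce
    qed
    ultimately show False by simp
  qed
  then obtain n v where "v \<in> interior (closure (B n))" by blast
  then obtain r where "r > 0" "ball v r \<subseteq> closure (B n)" by (auto simp: mem_interior)
  then show ?thesis unfolding B_def by (rule that)
qed

lemma representing_imp_norming: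
  fixes X :: "nat \<Rightarrow> 'a::banach set"
  assumes rep: "absolutely_representing_system X" and ne: "\<And>k. X k \<noteq> {}"
  obtains \<epsilon> where "\<epsilon> > 0"
    "\<And>\<phi> :: 'a \<Rightarrow> 'b::real_normed_vector. bounded_linear \<phi> \<Longrightarrow>
      \<epsilon> * onorm \<phi> \<le> (SUP k. onorm_on (X k) \<phi>)"
proof -
  obtain v n r where r: "r > 0"
    and ball: "ball v r \<subseteq> closure {suminf x | x. x \<in> l1_sequences X \<and> (\<Sum>k. norm (x k)) \<le> real n}"
    using representing_imp_ball_in_closure[OF rep] by blast
  show ?thesis
  proof
    \<comment> \<open>On \<open>ball v r\<close> the functional is bounded by \<open>(n + 1) * s\<close>, so on \<open>ball 0 r\<close> by twice that;
      the remaining factor \<open>2\<close> is lost in passing to a vector of norm \<open>r / 2\<close>. The summand \<open>1\<close>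
      only keeps the denominator nonzero for \<open>n = 0\<close>.\<close>
    show "r / (4 * (real n + 1)) > 0" using r by simp
    fix \<phi> :: "'a \<Rightarrow> 'b" assume \<phi>: "bounded_linear \<phi>"
    define s where "s = (SUP k. onorm_on (X k) \<phi>)"
    have s: "onorm_on (X k) \<phi> \<le> s" for k
      unfolding s_def by (intro cSUP_upper bdd_above_range_onorm_on \<phi> ne) simp
    have s0: "0 \<le> s"
    proof -
      obtain x where "x \<in> X 0" using ne by blast
      then have "norm (\<phi> x) / norm x \<le> onorm_on (X 0) \<phi>"
        unfolding onorm_on_def by (intro cSUP_upper bdd_above_onorm_on \<phi>)
      moreover have "0 \<le> norm (\<phi> x) / norm x" by simp
      ultimately show ?thesis using s[of 0] by linarith
    qed
    let ?C = "s * (real n + 1)"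
    have on_ball: "norm (\<phi> w) \<le> ?C" if "w \<in> ball v r" for w
    proof -
      have "{suminf x | x. x \<in> l1_sequences X \<and> (\<Sum>k. norm (x k)) \<le> real n} \<subseteq> {w. norm (\<phi> w) \<le> ?C}"
      proof clarify
        fix x assume x: "x \<in> l1_sequences X" "(\<Sum>k. norm (x k)) \<le> real n"
        have "norm (\<phi> (suminf x)) \<le> s * (\<Sum>k. norm (x k))"
          by (rule functional_bound_on_l1[OF \<phi> s x(1)])
        also have "\<dots> \<le> ?C" using x(2) s0 by (intro mult_left_mono) auto
        finally show "norm (\<phi> (suminf x)) \<le> ?C" .
      qed
      moreover have "closed {w. norm (\<phi> w) \<le> ?C}"
        by (intro closed_Collect_le continuous_on_norm linear_continuous_on[OF \<phi>]
            continuous_on_const)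
      ultimately have "closure {suminf x | x. x \<in> l1_sequences X \<and> (\<Sum>k. norm (x k)) \<le> real n}
          \<subseteq> {w. norm (\<phi> w) \<le> ?C}" by (rule closure_minimal)
      with ball that show ?thesis by blast
    qed
    have "onorm \<phi> \<le> 4 * ?C / r"
    proof (rule onorm_bound)
      show "0 \<le> 4 * ?C / r" using s0 r by simp
      fix x
      show "norm (\<phi> x) \<le> 4 * ?C / r * norm x"
      proof (cases "x = 0")
        case True
        then show ?thesis using linear_0[OF bounded_linear.linear[OF \<phi>]] by simp
      next
        case False
        define w where "w = (r / (2 * norm x)) *\<^sub>R x"
        have nw: "norm w = r / 2" using False r by (simp add: w_def)
        have "\<phi> w = \<phi> (v + w) - \<phi> v"
          using linear_diff[OF bounded_linear.linear[OF \<phi>], of "v + w" v] by simp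
        then have "norm (\<phi> w) \<le> norm (\<phi> (v + w)) + norm (\<phi> v)"
          by (simp add: norm_triangle_ineq4)
        also have "\<dots> \<le> ?C + ?C"
          using nw r by (intro add_mono on_ball) (auto simp: dist_norm)
        finally have "norm (\<phi> w) \<le> 2 * ?C" by simp
        moreover have "norm (\<phi> w) = r / (2 * norm x) * norm (\<phi> x)"
          using r by (simp add: w_def linear_cmul[OF bounded_linear.linear[OF \<phi>]])
        ultimately show ?thesis using r False by (simp add: field_simps)
      qed
    qed
    then show "r / (4 * (real n + 1)) * onorm \<phi> \<le> (SUP k. onorm_on (X k) \<phi>)"
      using r unfolding s_def[symmetric] by (simp add: field_simps)
  qed
qed

section \<open>A norming system is representing\<close>

subsection \<open>The defect seminorm\<close>

text \<open>
  The cost of representing \<open>v\<close>: the sum of the norms of the coefficients, plus the error of the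
  representation with weight \<open>1 / \<delta>\<close>.
\<close>

definition defect :: "(nat \<Rightarrow> 'a::banach set) \<Rightarrow> real \<Rightarrow> 'a \<Rightarrow> real" where
  "defect X \<delta> v = (INF x\<in>l1_sequences X. norm (v - suminf x) / \<delta> + (\<Sum>k. norm (x k)))"

lemma bdd_below_defect:
  fixes X :: "nat \<Rightarrow> 'a::banach set"
  assumes "\<delta> > 0"
  shows "bdd_below ((\<lambda>x. norm (v - suminf x) / \<delta> + (\<Sum>k. norm (x k))) ` l1_sequences X)"
  using assms by (intro bdd_belowI2[of _ 0] add_nonneg_nonneg suminf_nonneg)
    (auto dest: l1_sequencesD)

lemma defect_lower:
  assumes "\<delta> > 0" "x \<in> l1_sequences X"
  shows "defect X \<delta> v \<le> norm (v - suminf x) / \<delta> + (\<Sum>k. norm (x k))"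
  unfolding defect_def using assms by (intro cINF_lower bdd_below_defect)

context banach_space_over
begin

context
  fixes X :: "nat \<Rightarrow> 'a set" and \<delta> :: real
  assumes sub: "\<And>k. subspace (X k)" and \<delta>: "\<delta> > 0"
begin

lemma defect_greatest:
  assumes "\<And>x. x \<in> l1_sequences X \<Longrightarrow> m \<le> norm (v - suminf x) / \<delta> + (\<Sum>k. norm (x k))"
  shows "m \<le> defect X \<delta> v"
  unfolding defect_def using assms l1_sequences_zero[where X = X, OF sub] by (intro cINF_greatest) auto

lemma defect_le_norm: "defect X \<delta> v \<le> norm v / \<delta>"
  using defect_lower[OF \<delta> l1_sequences_zero[where X = X, OF sub], of v] by simp

lemma defect_le_norm_on_subspace:
  assumes "v \<in> X k"
  shows "defect X \<delta> v \<le> norm v"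
proof -
  have "(\<lambda>j. if j = k then v else 0) sums v"
    by (rule sums_If_finite_set[of "{k}" "\<lambda>_. v", simplified])
  moreover have "(\<lambda>j. norm (if j = k then v else 0)) sums norm v"
    using sums_If_finite_set[of "{k}" "\<lambda>_. norm v"] by (simp add: if_distrib cong: if_cong)
  ultimately show ?thesis
    using defect_lower[OF \<delta> l1_sequences_single[where X = X, OF sub assms], of v] by (simp add: sums_iff)
qed

lemma defect_add: "defect X \<delta> (v + w) \<le> defect X \<delta> v + defect X \<delta> w"
proof -
  let ?c = "\<lambda>v x. norm (v - suminf x) / \<delta> + (\<Sum>k. norm (x k))"
  have key: "defect X \<delta> (v + w) \<le> ?c v x + ?c w y"
    if x: "x \<in> l1_sequences X" and y: "y \<in> l1_sequences X" for x y
  proof -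
    note xy = l1_sequencesD[OF x] l1_sequencesD[OF y]
    note z = l1_sequences_add[where X = X, OF sub x y]
    have "suminf x + suminf y = (\<Sum>k. x k + y k)" using xy by (intro suminf_add)
    then have "norm (v + w - (\<Sum>k. x k + y k)) \<le> norm (v - suminf x) + norm (w - suminf y)"
      using norm_triangle_ineq[of "v - suminf x" "w - suminf y"] by (simp add: algebra_simps)
    then have "norm (v + w - (\<Sum>k. x k + y k)) / \<delta> \<le> norm (v - suminf x) / \<delta> + norm (w - suminf y) / \<delta>"
      using \<delta> by (simp add: divide_right_mono flip: add_divide_distrib)
    moreover have "(\<Sum>k. norm (x k + y k)) \<le> (\<Sum>k. norm (x k) + norm (y k))"
      using xy l1_sequencesD(2)[OF z] by (intro suminf_le summable_add norm_triangle_ineq)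
    moreover have "\<dots> = (\<Sum>k. norm (x k)) + (\<Sum>k. norm (y k))"
      using xy by (intro suminf_add[symmetric])
    ultimately show ?thesis using defect_lower[OF \<delta> z, of "v + w"] by linarith
  qed
  have "defect X \<delta> (v + w) - ?c w y \<le> defect X \<delta> v" if "y \<in> l1_sequences X" for y
    using key[OF _ that] by (intro defect_greatest) (simp only: diff_le_eq)
  then have "defect X \<delta> (v + w) - defect X \<delta> v \<le> defect X \<delta> w"
    by (intro defect_greatest) (simp only: diff_le_eq add.commute)
  then show ?thesis by simp
qed

lemma defect_scale: "defect X \<delta> (scl c v) = norm c * defect X \<delta> v"
proof -
  have le: "defect X \<delta> (scl c v) \<le> norm c * defect X \<delta> v" if c: "c \<noteq> 0" for c v
  proof -
    have "defect X \<delta> (scl c v) / norm c \<le> defect X \<delta> v"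
    proof (rule defect_greatest)
      fix x assume x: "x \<in> l1_sequences X"
      have "scl c (suminf x) = (\<Sum>k. scl c (x k))"
        by (intro bounded_linear.suminf bounded_linear_scl l1_sequencesD[OF x])
      then have "norm (scl c v - (\<Sum>k. scl c (x k))) = norm c * norm (v - suminf x)"
        by (metis norm_scale scale_right_diff_distrib)
      moreover have "(\<Sum>k. norm (scl c (x k))) = norm c * (\<Sum>k. norm (x k))"
        using suminf_mult[OF l1_sequencesD(2)[OF x], of "norm c"] by (simp add: norm_scale)
      ultimately have "defect X \<delta> (scl c v)
          \<le> norm c * (norm (v - suminf x) / \<delta> + (\<Sum>k. norm (x k)))"
        using defect_lower[OF \<delta> l1_sequences_scale[where X = X, OF sub x], of "scl c v" c]
        by (simp add: algebra_simps)
      then show "defect X \<delta> (scl c v) / norm c \<le> norm (v - suminf x) / \<delta> + (\<Sum>k. norm (x k))"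
        using c by (simp add: divide_le_eq mult.commute)
    qed
    with c show ?thesis by (simp add: divide_le_eq mult.commute)
  qed
  show ?thesis
  proof (cases "c = 0")
    case True
    have "0 \<le> defect X \<delta> 0"
      using \<delta> by (intro defect_greatest add_nonneg_nonneg suminf_nonneg) (auto dest: l1_sequencesD)
    with True defect_le_norm[of 0] show ?thesis by simp
  next
    case False
    have "defect X \<delta> (scl (inverse c) (scl c v)) \<le> norm (inverse c) * defect X \<delta> (scl c v)"
      using False by (intro le) simp
    with False have "defect X \<delta> v \<le> defect X \<delta> (scl c v) / norm c"
      by (simp add: norm_divide inverse_eq_divide)
    with False have "norm c * defect X \<delta> v \<le> defect X \<delta> (scl c v)"
      by (simp add: pos_le_divide_eq mult.commute)
    with le[OF False, of v] show ?thesis by simp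
  qed
qed

lemma defect_le:
  assumes \<epsilon>: "\<epsilon> > 0"
    and norming: "\<And>\<phi>. \<phi> \<in> dual_space scl \<Longrightarrow> \<epsilon> * onorm \<phi> \<le> (SUP k. onorm_on (X k) \<phi>)"
  shows "defect X \<delta> y \<le> norm y / \<epsilon>"
proof -
  obtain \<phi> where \<phi>: "\<phi> \<in> dual_space scl" "\<And>x. norm (\<phi> x) \<le> defect X \<delta> x"
    "norm (\<phi> y) = defect X \<delta> y"
  proof (rule hahn_banach_seminorm)
    show "defect X \<delta> x \<le> norm x * (1 / \<delta>)" for x using defect_le_norm by simp
  qed (use defect_add defect_scale in auto)
  have bl: "bounded_linear \<phi>" using \<phi>(1) by (simp add: dual_space_def)
  have "onorm_on (X k) \<phi> \<le> 1" for k
  proof (rule onorm_on_le)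
    show "X k \<noteq> {}" using subspace_0[OF sub] by blast
    show "norm (\<phi> x) \<le> 1 * norm x" if "x \<in> X k" for x
      using \<phi>(2)[of x] defect_le_norm_on_subspace[OF that] by simp
  qed simp
  then have "(SUP k. onorm_on (X k) \<phi>) \<le> 1" by (intro cSUP_least) auto
  with norming[OF \<phi>(1)] have "onorm \<phi> \<le> 1 / \<epsilon>" using \<epsilon> by (simp add: field_simps)
  then have "onorm \<phi> * norm y \<le> 1 / \<epsilon> * norm y" by (intro mult_right_mono) auto
  then show ?thesis using onorm[OF bl, of y] by (simp add: \<phi>(3))
qed

end

text \<open>
  With \<open>\<delta> = \<epsilon> / 4\<close> a cost below \<open>(2 / \<epsilon>) * \<parallel>y\<parallel>\<close> forces the error to be at most \<open>\<parallel>y\<parallel> / 2\<close>.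
\<close>

lemma norming_imp_half_approximation:
  fixes X :: "nat \<Rightarrow> 'a set" and y :: 'a
  assumes sub: "\<And>k. subspace (X k)" and \<epsilon>: "\<epsilon> > 0"
    and norming: "\<And>\<phi>. \<phi> \<in> dual_space scl \<Longrightarrow> \<epsilon> * onorm \<phi> \<le> (SUP k. onorm_on (X k) \<phi>)"
  shows "\<exists>x\<in>l1_sequences X. norm (y - suminf x) \<le> norm y / 2 \<and> (\<Sum>k. norm (x k)) \<le> 2 / \<epsilon> * norm y"
proof (cases "y = 0")
  case True
  then show ?thesis using l1_sequences_zero[where X = X, OF sub] by (intro bexI[of _ "\<lambda>k. 0"]) auto
next
  case False
  have \<delta>: "\<epsilon> / 4 > 0" using \<epsilon> by simp
  have "defect X (\<epsilon> / 4) y \<le> norm y / \<epsilon>"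
    by (rule defect_le[OF sub \<delta> \<epsilon> norming])
  also have "\<dots> < 2 / \<epsilon> * norm y" using \<epsilon> False by (simp add: field_simps)
  finally obtain x where x: "x \<in> l1_sequences X"
    and lt: "norm (y - suminf x) / (\<epsilon> / 4) + (\<Sum>k. norm (x k)) < 2 / \<epsilon> * norm y"
    unfolding defect_def using l1_sequences_zero[where X = X, OF sub]
    by (subst (asm) cINF_less_iff[OF _ bdd_below_defect[OF \<delta>]]) auto
  have "0 \<le> (\<Sum>k. norm (x k))" using l1_sequencesD(2)[OF x] by (intro suminf_nonneg) auto
  with lt have "norm (y - suminf x) / (\<epsilon> / 4) < 2 / \<epsilon> * norm y" by linarith
  then have "norm (y - suminf x) \<le> norm y / 2" using \<epsilon> by (simp add: field_simps)
  moreover have "0 \<le> norm (y - suminf x) / (\<epsilon> / 4)" using \<epsilon> by simp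
  with lt have "(\<Sum>k. norm (x k)) \<le> 2 / \<epsilon> * norm y" by linarith
  ultimately show ?thesis using x by blast
qed

end

subsection \<open>Summing up the approximations\<close>

lemma infsum_eq_suminf:
  fixes f :: "nat \<Rightarrow> 'a::banach"
  assumes "summable (\<lambda>n. norm (f n))"
  shows "infsum f UNIV = suminf f"
  using norm_summable_imp_has_sum[OF assms summable_sums[OF summable_norm_cancel[OF assms]]]
  by (rule infsumI)

text \<open>
  An absolutely convergent double series may be summed by columns instead of by rows; that the
  \<open>X k\<close> are closed keeps the column sums in them.
\<close>

lemma (in banach_space_over) l1_sequences_sum_columns:
  fixes X :: "nat \<Rightarrow> 'a set" and z :: "nat \<Rightarrow> nat \<Rightarrow> 'a"
  assumes sub: "\<And>k. subspace (X k)" and cl: "\<And>k. closed (X k)"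
    and z: "\<And>n. z n \<in> l1_sequences X" and S: "summable (\<lambda>n. \<Sum>k. norm (z n k))"
  shows "(\<lambda>k. \<Sum>n. z n k) \<in> l1_sequences X" "(\<Sum>k. \<Sum>n. z n k) = (\<Sum>n. suminf (z n))"
proof -
  have rows: "summable (\<lambda>k. norm (z n k))" for n by (rule l1_sequencesD(2)[OF z])
  have rows_nonneg: "0 \<le> (\<Sum>k. norm (z n k))" for n by (intro suminf_nonneg rows) simp
  have row_infsum: "(\<Sum>\<^sub>\<infinity>k. norm (z n k)) = (\<Sum>k. norm (z n k))" for n
    using rows[of n] by (intro infsum_eq_suminf) simp
  have abs: "(\<lambda>p. norm (case p of (n, k) \<Rightarrow> z n k)) summable_on UNIV \<times> UNIV"
    using rows S rows_nonneg
    by (intro iffD2[OF Infinite_Sum.abs_summable_on_Sigma_iff])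
      (simp add: row_infsum summable_on_UNIV_nonneg_real_iff)
  then have "(\<lambda>p. norm (case p of (k, n) \<Rightarrow> z n k)) summable_on UNIV \<times> UNIV"
    by (subst (asm) summable_on_swap) (simp add: case_prod_unfold)
  note swapped = iffD1[OF Infinite_Sum.abs_summable_on_Sigma_iff this]
  have cols: "summable (\<lambda>n. norm (z n k))" for k
    using swapped by (simp add: summable_on_UNIV_nonneg_real_iff)
  have cols_sum: "summable (\<lambda>k. \<Sum>\<^sub>\<infinity>n. norm (z n k))"
    using swapped by (simp add: summable_on_UNIV_nonneg_real_iff infsum_nonneg)
  have col_infsum: "(\<Sum>\<^sub>\<infinity>n. norm (z n k)) = (\<Sum>n. norm (z n k))" for k
    using cols[of k] by (intro infsum_eq_suminf) simp
  have norm_le: "norm (\<Sum>n. z n k) \<le> (\<Sum>n. norm (z n k))" for k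
    by (rule summable_norm[OF cols])
  have col_norms: "summable (\<lambda>k. norm (\<Sum>n. z n k))"
    by (rule summable_comparison_test'[OF cols_sum[unfolded col_infsum]]) (simp add: norm_le)
  have mem: "(\<Sum>n. z n k) \<in> X k" for k
  proof (rule closed_sequentially[OF cl])
    show "(\<Sum>n<m. z n k) \<in> X k" for m
      by (intro subspace_sum sub l1_sequencesD(1)[OF z])
    show "(\<lambda>m. \<Sum>n<m. z n k) \<longlonglongrightarrow> (\<Sum>n. z n k)"
      by (intro summable_LIMSEQ summable_norm_cancel[OF cols])
  qed
  show "(\<lambda>k. \<Sum>n. z n k) \<in> l1_sequences X"
    using mem col_norms by (simp add: l1_sequences_def)
  have row_norms: "summable (\<lambda>n. norm (suminf (z n)))"
    by (rule summable_comparison_test'[OF S]) (simp add: summable_norm[OF rows])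
  have "(\<Sum>k. \<Sum>n. z n k) = (\<Sum>\<^sub>\<infinity>k. \<Sum>\<^sub>\<infinity>n. z n k)"
    by (simp add: infsum_eq_suminf[OF cols] infsum_eq_suminf[OF col_norms])
  also have "\<dots> = (\<Sum>\<^sub>\<infinity>n. \<Sum>\<^sub>\<infinity>k. z n k)"
    by (rule infsum_swap_banach[symmetric]) (rule abs_summable_summable[OF abs])
  also have "\<dots> = (\<Sum>n. suminf (z n))"
    by (simp add: infsum_eq_suminf[OF rows] infsum_eq_suminf[OF row_norms])
  finally show "(\<Sum>k. \<Sum>n. z n k) = (\<Sum>n. suminf (z n))" .
qed

text \<open>
  The remainders \<open>r n\<close> of the iterated approximation at least halve at each step, so the costs
  form a convergent series.
\<close>

lemma (in banach_space_over) half_approximation_imp_representing: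
  fixes X :: "nat \<Rightarrow> 'a set"
  assumes sub: "\<And>k. subspace (X k)" and cl: "\<And>k. closed (X k)"
    and approx: "\<And>y. \<exists>x\<in>l1_sequences X.
      norm (y - suminf x) \<le> norm y / 2 \<and> (\<Sum>k. norm (x k)) \<le> C * norm y"
  shows "absolutely_representing_system X"
  unfolding absolutely_representing_system_iff
proof
  fix y
  obtain g where g: "\<And>v. g v \<in> l1_sequences X"
    and half: "\<And>v. norm (v - suminf (g v)) \<le> norm v / 2"
    and cost: "\<And>v. (\<Sum>k. norm (g v k)) \<le> C * norm v"
    using approx by metis
  define r where "r n = ((\<lambda>v. v - suminf (g v)) ^^ n) y" for n
  have r_0: "r 0 = y" and r_Suc: "r (Suc n) = r n - suminf (g (r n))" for n
    by (simp_all add: r_def)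
  have r_le: "norm (r n) \<le> norm y / 2 ^ n" for n
  proof (induction n)
    case (Suc n)
    then show ?case using half[of "r n"] by (simp add: r_Suc)
  qed (simp add: r_0)
  have "(\<lambda>n. norm y / 2 ^ n) \<longlonglongrightarrow> 0" by (rule LIMSEQ_divide_realpow_zero) simp
  then have "r \<longlonglongrightarrow> 0"
    by (rule Lim_null_comparison[rotated]) (simp add: r_le)
  then have "(\<lambda>n. r n - r (Suc n)) sums (r 0 - 0)" by (rule telescope_sums')
  then have sums: "(\<lambda>n. suminf (g (r n))) sums y" by (simp add: r_Suc r_0)
  have nonneg: "0 \<le> (\<Sum>k. norm (g v k))" for v
    using l1_sequencesD(2)[OF g] by (intro suminf_nonneg) auto
  have geometric: "norm (\<Sum>k. norm (g (r n) k)) \<le> \<bar>C\<bar> * norm y * (1 / 2) ^ n" for n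
  proof -
    have "(\<Sum>k. norm (g (r n) k)) \<le> \<bar>C\<bar> * norm (r n)"
      using cost[of "r n"] mult_right_mono[OF abs_ge_self[of C], of "norm (r n)"] by simp
    also have "\<dots> \<le> \<bar>C\<bar> * (norm y / 2 ^ n)" by (intro mult_left_mono r_le) simp
    finally show ?thesis using nonneg by (simp add: power_one_over field_simps)
  qed
  have "summable (\<lambda>n. \<bar>C\<bar> * norm y * (1 / 2 :: real) ^ n)"
    by (intro summable_mult summable_geometric) simp
  then have S: "summable (\<lambda>n. \<Sum>k. norm (g (r n) k))"
    by (rule summable_comparison_test'[where N = 0]) (rule geometric)
  note columns = l1_sequences_sum_columns[where X = X and z = "\<lambda>n. g (r n)", OF sub cl g S]
  show "\<exists>x\<in>l1_sequences X. suminf x = y"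
    using columns sums by (intro bexI[OF _ columns(1)]) (simp add: sums_iff)
qed

theorem mainTheorem7:
  fixes scl :: "'k::real_or_complex \<Rightarrow> 'a::banach \<Rightarrow> 'a"
    and X :: "nat \<Rightarrow> 'a set"
  assumes "normed_space_over scl"
    and "\<And>k. module.subspace scl (X k)"
    and "\<And>k. closed (X k)"
  shows "absolutely_representing_system X \<longleftrightarrow>
    (\<exists>\<epsilon>>0. \<forall>\<phi>\<in>dual_space scl. (SUP k. onorm_on (X k) \<phi>) \<ge> \<epsilon> * onorm \<phi>)"
proof
  interpret banach_space_over scl
    using assms(1) by (simp add: banach_space_over_def)
  note sub = assms(2)
  show "\<exists>\<epsilon>>0. \<forall>\<phi>\<in>dual_space scl. (SUP k. onorm_on (X k) \<phi>) \<ge> \<epsilon> * onorm \<phi>"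
    if rep: "absolutely_representing_system X"
  proof -
    have ne: "X k \<noteq> {}" for k using subspace_0[OF sub] by blast
    obtain \<epsilon> where "\<epsilon> > 0" and le: "\<And>\<phi> :: 'a \<Rightarrow> 'k. bounded_linear \<phi> \<Longrightarrow>
        \<epsilon> * onorm \<phi> \<le> (SUP k. onorm_on (X k) \<phi>)"
      using representing_imp_norming[OF rep ne] by blast
    then show ?thesis by (auto simp: dual_space_def)
  qed
  show "absolutely_representing_system X"
    if "\<exists>\<epsilon>>0. \<forall>\<phi>\<in>dual_space scl. (SUP k. onorm_on (X k) \<phi>) \<ge> \<epsilon> * onorm \<phi>"
  proof -
    obtain \<epsilon> where \<epsilon>: "\<epsilon> > 0"
      and norming: "\<And>\<phi>. \<phi> \<in> dual_space scl \<Longrightarrow> \<epsilon> * onorm \<phi> \<le> (SUP k. onorm_on (X k) \<phi>)"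
      using \<open>\<exists>\<epsilon>>0. _ \<epsilon>\<close> by blast
    show ?thesis
      using norming_imp_half_approximation[where X = X, OF sub \<epsilon> norming]
      by (rule half_approximation_imp_representing[where X = X, OF sub assms(3)])
  qed
qed

end
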